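(* Let $n,k$ be positive integers with $k\le n-1$, and let \[ F_{n,k}(x)=\sum_{j=0}^{k} a_j c_j x^j,\qquad c_j=\binom{n}{j}\binom{n-j-1}{k-j}(-1)^{k-j}, \] where $a_0,\dots,a_k$ are nonzero integers each of whose prime factors is $\le k$. If there is a prime $p>k$ that exactly divides $n(n-k)$ (i.e. $p\mid n(n-k)$ and $p^2\nmid n(n-k)$), then $F_{n,k}(x)$ is irreducible over $\mathbb{Q}$ for every such choice of $a_0,\dots,a_k$.
   Context: An integer "having all of its prime factors $\le k$" is a nonzero integer (possibly $\pm 1$) with no prime divisor exceeding $k$. *)

theory Defs
  imports Complex_Main "HOL-Computational_Algebra.Computational_Algebra"
begin

definition prime_factors_at_most :: "nat \<Rightarrow> int \<Rightarrow> bool" where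
  "prime_factors_at_most k a \<longleftrightarrow> a \<noteq> 0 \<and> (\<forall>q::nat. prime q \<longrightarrow> int q dvd a \<longrightarrow> q \<le> k)"

definition trunc_coeff :: "nat \<Rightarrow> nat \<Rightarrow> nat \<Rightarrow> int" where
  "trunc_coeff n k j = int (n choose j) * int ((n - j - 1) choose (k - j)) * (-1) ^ (k - j)"

text \<open>The natural-number subtractions above do not truncate in the range
  \<open>j \<le> k \<le> n - 1\<close>, \<open>n > 0\<close>, in which the coefficients are used.\<close>

definition trunc_poly :: "nat \<Rightarrow> nat \<Rightarrow> (nat \<Rightarrow> int) \<Rightarrow> int poly" where
  "trunc_poly n k a = (\<Sum>j=0..k. monom (a j * trunc_coeff n k j) j)"

end

theory Submission
  imports Defs "Berlekamp_Zassenhaus.Factorize_Int_Poly"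
begin

text \<open>
  Multiplying \<open>c\<^sub>j\<close> by \<open>k!\<close> turns it, up to sign, into
  \<open>(k choose j) * (\<Prod>i\<in>{0..k} - {j}. n - i)\<close>. A prime \<open>p > k\<close> divides neither \<open>k!\<close> nor
  \<open>k choose j\<close>, and at most one of the \<open>k + 1\<close> consecutive integers \<open>n - k, \<dots>, n\<close>. So if \<open>p\<close> exactly
  divides \<open>n - m\<close> with \<open>m \<le> k\<close>, it exactly divides every \<open>c\<^sub>j\<close> except \<open>c\<^sub>m\<close>, which it does not divide.
  For \<open>m = k\<close> this makes the polynomial Eisenstein at \<open>p\<close>, and for \<open>m = 0\<close> its reciprocal.
\<close>

subsection \<open>Eisenstein's criterion\<close>

definition eisenstein_at :: "'a :: comm_ring_1 \<Rightarrow> 'a poly \<Rightarrow> bool" where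
  "eisenstein_at p F \<longleftrightarrow> degree F > 0 \<and> \<not> p dvd lead_coeff F \<and>
     (\<forall>i<degree F. p dvd coeff F i) \<and> \<not> p ^ 2 dvd coeff F 0"

lemma eisenstein_at_reflect_poly_iff:
  assumes "coeff F 0 \<noteq> 0"
  shows "eisenstein_at p (reflect_poly F) \<longleftrightarrow> degree F > 0 \<and> \<not> p dvd coeff F 0 \<and>
    (\<forall>i\<in>{0<..degree F}. p dvd coeff F i) \<and> \<not> p ^ 2 dvd lead_coeff F"
proof -
  have "bij_betw (\<lambda>i. degree F - i) {..<degree F} {0<..degree F}"
    by (rule bij_betwI [where g = "\<lambda>i. degree F - i"]) auto
  then have "{0<..degree F} = (\<lambda>i. degree F - i) ` {..<degree F}"
    by (simp add: bij_betw_imp_surj_on)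
  then have "(\<forall>i\<in>{0<..degree F}. p dvd coeff F i) \<longleftrightarrow> (\<forall>i<degree F. p dvd coeff F (degree F - i))"
    by (simp only:) auto
  then show ?thesis
    using assms by (simp add: eisenstein_at_def coeff_reflect_poly)
qed

lemma prime_elem_not_dvd_coeff_mult:
  fixes p :: "'a :: comm_ring_1" and G H :: "'a poly"
  assumes "prime_elem p"
    and below_r: "\<And>i. i < r \<Longrightarrow> p dvd coeff G i" and "\<not> p dvd coeff G r"
    and below_s: "\<And>i. i < s \<Longrightarrow> p dvd coeff H i" and "\<not> p dvd coeff H s"
  shows "\<not> p dvd coeff (G * H) (r + s)"
proof -
  have "coeff (G * H) (r + s) = (\<Sum>i\<le>r + s. coeff G i * coeff H (r + s - i))"
    by (rule coeff_mult)
  also have "\<dots> = coeff G r * coeff H s + (\<Sum>i\<in>{..r + s} - {r}. coeff G i * coeff H (r + s - i))"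
    by (subst sum.remove [where x = r]) auto
  finally have coeff_eq: "coeff (G * H) (r + s) =
    coeff G r * coeff H s + (\<Sum>i\<in>{..r + s} - {r}. coeff G i * coeff H (r + s - i))" .
  have "p dvd (\<Sum>i\<in>{..r + s} - {r}. coeff G i * coeff H (r + s - i))"
  proof (rule dvd_sum)
    fix i assume "i \<in> {..r + s} - {r}"
    then consider "i < r" | "r + s - i < s" by fastforce
    then show "p dvd coeff G i * coeff H (r + s - i)"
      using below_r below_s by cases simp_all
  qed
  moreover have "\<not> p dvd coeff G r * coeff H s"
    using assms by (simp add: prime_elem_dvd_mult_iff)
  ultimately show ?thesis
    by (simp add: coeff_eq dvd_add_left_iff)
qed

lemma eisenstein_at_degree_factor_eq_0:
  fixes p :: "'a :: idom" and G H :: "'a poly"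
  assumes "prime_elem p" and eisenstein: "eisenstein_at p (G * H)" and H_0: "\<not> p dvd coeff H 0"
  shows "degree H = 0"
proof -
  have lead: "\<not> p dvd lead_coeff (G * H)"
    using eisenstein by (simp add: eisenstein_at_def)
  then have lead_G: "\<not> p dvd lead_coeff G"
    by (auto simp: lead_coeff_mult)
  define r where "r = (LEAST i. \<not> p dvd coeff G i)"
  have at_r: "\<not> p dvd coeff G r"
    unfolding r_def using lead_G by (rule LeastI)
  have r_le: "r \<le> degree G"
    unfolding r_def using lead_G by (rule Least_le)
  have below_r: "p dvd coeff G i" if "i < r" for i
    using that not_less_Least unfolding r_def by blast
  have "\<not> p dvd coeff (G * H) r"
    using prime_elem_not_dvd_coeff_mult [OF \<open>prime_elem p\<close> below_r at_r _ H_0] by simp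
  then have "degree (G * H) \<le> r"
    using eisenstein by (auto simp: eisenstein_at_def not_less [symmetric])
  moreover have "degree (G * H) = degree G + degree H"
    using lead by (intro degree_mult_eq) auto
  ultimately show ?thesis
    using r_le by simp
qed

theorem irreducible\<^sub>d_eisenstein:
  fixes p :: "'a :: idom" and F :: "'a poly"
  assumes "prime_elem p" and eisenstein: "eisenstein_at p F"
  shows "irreducible\<^sub>d F"
proof (rule irreducible\<^sub>dI)
  show "degree F > 0"
    using eisenstein by (simp add: eisenstein_at_def)
  fix G H assume "degree G > 0" and "degree H > 0" and F: "F = G * H"
  have "coeff F 0 = coeff G 0 * coeff H 0"
    by (simp add: F coeff_mult)
  then have "\<not> p dvd coeff G 0 \<or> \<not> p dvd coeff H 0"
    using eisenstein by (auto simp: eisenstein_at_def power2_eq_square intro: mult_dvd_mono)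
  then show False
  proof
    assume "\<not> p dvd coeff G 0"
    then have "degree G = 0"
      using eisenstein_at_degree_factor_eq_0 [of p H G] assms F by (simp add: mult.commute)
    then show False
      using \<open>degree G > 0\<close> by simp
  next
    assume "\<not> p dvd coeff H 0"
    then have "degree H = 0"
      using eisenstein_at_degree_factor_eq_0 [of p G H] assms F by simp
    then show False
      using \<open>degree H > 0\<close> by simp
  qed
qed

corollary irreducible_eisenstein_rat:
  fixes p :: int and F :: "int poly"
  assumes "prime_elem p" and "eisenstein_at p F"
  shows "irreducible (map_poly rat_of_int F)"
  using irreducible\<^sub>d_int_rat [OF irreducible\<^sub>d_eisenstein [OF assms]] by simp

corollary irreducible_eisenstein_reflect_rat:
  fixes p :: int and F :: "int poly"
  assumes "prime_elem p" and "eisenstein_at p (reflect_poly F)" and "coeff F 0 \<noteq> 0"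
  shows "irreducible (map_poly rat_of_int F)"
proof -
  have "irreducible\<^sub>d F"
    using irreducible\<^sub>d_eisenstein [OF assms(1,2)] irreducible\<^sub>d_reflect_poly [OF assms(3)] by simp
  from irreducible\<^sub>d_int_rat [OF this] show ?thesis
    by simp
qed

subsection \<open>Divisibility of the coefficients\<close>

lemma fact_mult_binomial_eq_prod: "fact m * int (N choose m) = (\<Prod>i<m. int N - int i)"
proof -
  have "real_of_int (fact m * int (N choose m)) = real_of_int (\<Prod>i<m. int N - int i)"
    by (simp add: binomial_gbinomial gbinomial_mult_fact atLeast0LessThan)
  then show ?thesis
    by (simp only: of_int_eq_iff)
qed

lemma fact_mult_trunc_coeff:
  assumes "k < n" and "j \<le> k"
  shows "fact k * trunc_coeff n k j =
    (-1) ^ (k - j) * int (k choose j) * (\<Prod>i\<in>{..k} - {j}. int n - int i)"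
proof -
  have "fact (k - j) * int ((n - j - 1) choose (k - j)) = (\<Prod>i<k - j. int (n - j - 1) - int i)"
    by (rule fact_mult_binomial_eq_prod)
  also have "\<dots> = (\<Prod>i\<in>{j<..k}. int n - int i)"
    using assms by (intro prod.reindex_bij_witness [of _ "\<lambda>i. i - j - 1" "\<lambda>i. i + j + 1"]) auto
  finally have second_factor: "fact (k - j) * int ((n - j - 1) choose (k - j)) =
    (\<Prod>i\<in>{j<..k}. int n - int i)" .
  have "{..k} - {j} = {..<j} \<union> {j<..k}"
    using assms(2) by auto
  moreover have "{..<j} \<inter> {j<..k} = {}"
    by auto
  ultimately have prod_split: "(\<Prod>i\<in>{..k} - {j}. int n - int i) =
    (\<Prod>i<j. int n - int i) * (\<Prod>i\<in>{j<..k}. int n - int i)"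
    by (simp add: prod.union_disjoint)
  have "fact k = fact j * fact (k - j) * int (k choose j)"
    using binomial_fact_lemma [OF assms(2)] by (metis of_nat_fact of_nat_mult)
  then have "fact k * trunc_coeff n k j = (-1) ^ (k - j) * int (k choose j) *
    ((fact j * int (n choose j)) * (fact (k - j) * int ((n - j - 1) choose (k - j))))"
    by (simp only: trunc_coeff_def mult_ac)
  then show ?thesis
    unfolding fact_mult_binomial_eq_prod [of j] second_factor prod_split .
qed

lemma prime_elem_power_dvd_mult_cancel_left:
  fixes p :: "'a :: algebraic_semidom"
  assumes "prime_elem p" and "\<not> p dvd x"
  shows "p ^ e dvd x * y \<longleftrightarrow> p ^ e dvd y"
  using assms prime_power_dvd_multD [of p e x y] by (cases "e = 0") auto

lemma prime_power_dvd_trunc_coeff_iff_dvd_prod: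
  fixes p :: nat
  assumes "prime p" and "k < p" and "k < n" and "j \<le> k"
  shows "int p ^ e dvd trunc_coeff n k j \<longleftrightarrow> int p ^ e dvd (\<Prod>i\<in>{..k} - {j}. int n - int i)"
proof -
  have prime_elem: "prime_elem (int p)"
    using assms(1) by auto
  have not_dvd_fact: "\<not> p dvd fact k"
    using assms(1,2) by (simp add: prime_dvd_fact_iff)
  moreover have "(k choose j) dvd fact k"
    using binomial_fact_lemma [OF assms(4)] by (metis dvd_triv_right)
  ultimately have "\<not> p dvd k choose j"
    using dvd_trans by blast
  then have not_dvd: "\<not> int p dvd fact k" "\<not> int p dvd (-1) ^ (k - j) * int (k choose j)"
    using not_dvd_fact by (metis int_dvd_int_iff of_nat_fact, cases "even (k - j)") simp_all
  have "int p ^ e dvd trunc_coeff n k j \<longleftrightarrow> int p ^ e dvd fact k * trunc_coeff n k j"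
    using prime_elem_power_dvd_mult_cancel_left [OF prime_elem not_dvd(1)] by simp
  also have "\<dots> \<longleftrightarrow> int p ^ e dvd (\<Prod>i\<in>{..k} - {j}. int n - int i)"
    unfolding fact_mult_trunc_coeff [OF assms(3,4)]
    by (rule prime_elem_power_dvd_mult_cancel_left [OF prime_elem not_dvd(2)])
  finally show ?thesis .
qed

lemma prime_not_dvd_prod_diff:
  fixes p :: nat and x :: int
  assumes "prime p" and "k < p" and "m \<le> k" and "int p dvd x - int m" and "A \<subseteq> {..k} - {m}"
  shows "\<not> int p dvd (\<Prod>i\<in>A. x - int i)"
proof
  assume "int p dvd (\<Prod>i\<in>A. x - int i)"
  moreover have "finite A"
    using assms(5) by (rule finite_subset) simp
  ultimately obtain i where "i \<in> A" and dvd_i: "int p dvd x - int i"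
    using assms(1) by (auto simp: prime_dvd_prod_iff)
  have "int p dvd (x - int i) - (x - int m)"
    using dvd_i assms(4) by (rule dvd_diff)
  moreover have "0 < \<bar>int m - int i\<bar>" "\<bar>int m - int i\<bar> < int p"
    using \<open>i \<in> A\<close> assms(2,3,5) by auto
  ultimately show False
    using zdvd_not_zless [of "\<bar>int m - int i\<bar>" "int p"] by simp
qed

lemma prime_power_dvd_trunc_coeff_iff:
  fixes p :: nat
  assumes "prime p" and "k < p" and "k < n" and "j \<le> k" and "m \<le> k" and "p dvd n - m"
  shows "int p ^ e dvd trunc_coeff n k j \<longleftrightarrow> (if j = m then e = 0 else p ^ e dvd n - m)"
proof -
  have int_diff: "int n - int m = int (n - m)"
    using assms(3,5) by simp
  have not_dvd_prod: "\<not> int p dvd (\<Prod>i\<in>{..k} - {j} - {m}. int n - int i)"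
    using assms(6) by (intro prime_not_dvd_prod_diff [OF assms(1,2,5)]) (auto simp: int_diff)
  show ?thesis
  proof (cases "j = m")
    case True
    then have "int p ^ e dvd trunc_coeff n k j \<longleftrightarrow>
      int p ^ e dvd (\<Prod>i\<in>{..k} - {j} - {m}. int n - int i) * 1"
      using prime_power_dvd_trunc_coeff_iff_dvd_prod [OF assms(1-4)] by simp
    also have "\<dots> \<longleftrightarrow> int p ^ e dvd 1"
      using assms(1) not_dvd_prod by (intro prime_elem_power_dvd_mult_cancel_left) auto
    also have "\<dots> \<longleftrightarrow> e = 0"
      using assms(1) by (auto simp: is_unit_power_iff)
    finally show ?thesis
      using True by simp
  next
    case False
    have "(\<Prod>i\<in>{..k} - {j}. int n - int i) =
      (int n - int m) * (\<Prod>i\<in>{..k} - {j} - {m}. int n - int i)"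
      using False assms(5) by (intro prod.remove) simp_all
    then have "int p ^ e dvd trunc_coeff n k j \<longleftrightarrow>
      int p ^ e dvd (\<Prod>i\<in>{..k} - {j} - {m}. int n - int i) * (int n - int m)"
      using prime_power_dvd_trunc_coeff_iff_dvd_prod [OF assms(1-4)] by (simp only: mult.commute)
    also have "\<dots> \<longleftrightarrow> int p ^ e dvd int n - int m"
      using assms(1) not_dvd_prod by (intro prime_elem_power_dvd_mult_cancel_left) auto
    also have "\<dots> \<longleftrightarrow> p ^ e dvd n - m"
      unfolding int_diff by (subst int_dvd_int_iff [symmetric]) simp
    finally show ?thesis
      using False by simp
  qed
qed

subsection \<open>The truncated binomial polynomial\<close>

lemma coeff_trunc_poly: "coeff (trunc_poly n k a) j = (if j \<le> k then a j * trunc_coeff n k j else 0)"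
  by (simp add: trunc_poly_def coeff_sum)

lemma coeff_trunc_poly_nonzero:
  assumes "k < n" and "j \<le> k" and "prime_factors_at_most k (a j)"
  shows "coeff (trunc_poly n k a) j \<noteq> 0"
  using assms by (simp add: coeff_trunc_poly trunc_coeff_def prime_factors_at_most_def)

lemma degree_trunc_poly:
  assumes "k < n" and "prime_factors_at_most k (a k)"
  shows "degree (trunc_poly n k a) = k"
  using assms coeff_trunc_poly_nonzero [of k n k a]
  by (intro antisym degree_le le_degree) (simp_all add: coeff_trunc_poly)

lemma prime_power_dvd_coeff_trunc_poly_iff:
  fixes p :: nat
  assumes "prime p" and "k < p" and "k < n" and "j \<le> k" and "m \<le> k" and "p dvd n - m"
    and "prime_factors_at_most k (a j)"
  shows "int p ^ e dvd coeff (trunc_poly n k a) j \<longleftrightarrow> (if j = m then e = 0 else p ^ e dvd n - m)"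
proof -
  have "\<not> int p dvd a j"
    using assms(1,2,7) by (auto simp: prime_factors_at_most_def)
  then have "int p ^ e dvd coeff (trunc_poly n k a) j \<longleftrightarrow> int p ^ e dvd trunc_coeff n k j"
    using assms(1,4) prime_elem_power_dvd_mult_cancel_left [of "int p" "a j"]
    by (simp add: coeff_trunc_poly)
  then show ?thesis
    using prime_power_dvd_trunc_coeff_iff [OF assms(1-6)] by simp
qed

lemma eisenstein_at_trunc_poly:
  fixes p :: nat
  assumes "prime p" and "k < p" and "0 < k" and "k < n"
    and "p dvd n - k" and "\<not> p ^ 2 dvd n - k"
    and smooth: "\<And>j. j \<le> k \<Longrightarrow> prime_factors_at_most k (a j)"
  shows "eisenstein_at (int p) (trunc_poly n k a)"
proof -
  have deg: "degree (trunc_poly n k a) = k"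
    using assms(4) smooth by (simp add: degree_trunc_poly)
  have dvd_coeff: "int p ^ e dvd coeff (trunc_poly n k a) j \<longleftrightarrow>
    (if j = k then e = 0 else p ^ e dvd n - k)" if "j \<le> k" for e j
    using assms that by (intro prime_power_dvd_coeff_trunc_poly_iff) auto
  show ?thesis
    unfolding eisenstein_at_def deg
  proof (intro conjI allI impI)
    show "0 < k"
      by fact
    show "\<not> int p dvd coeff (trunc_poly n k a) k"
      using dvd_coeff [of k 1] by simp
    show "int p dvd coeff (trunc_poly n k a) i" if "i < k" for i
      using dvd_coeff [of i 1] that assms(5) by simp
    show "\<not> int p ^ 2 dvd coeff (trunc_poly n k a) 0"
      using dvd_coeff [of 0 2] assms(3,6) by simp
  qed
qed

lemma eisenstein_at_reflect_trunc_poly: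
  fixes p :: nat
  assumes "prime p" and "k < p" and "0 < k" and "k < n"
    and "p dvd n" and "\<not> p ^ 2 dvd n"
    and smooth: "\<And>j. j \<le> k \<Longrightarrow> prime_factors_at_most k (a j)"
  shows "eisenstein_at (int p) (reflect_poly (trunc_poly n k a))"
proof -
  have deg: "degree (trunc_poly n k a) = k"
    using assms(4) smooth by (simp add: degree_trunc_poly)
  have dvd_coeff: "int p ^ e dvd coeff (trunc_poly n k a) j \<longleftrightarrow>
    (if j = 0 then e = 0 else p ^ e dvd n)" if "j \<le> k" for e j
    using assms that prime_power_dvd_coeff_trunc_poly_iff [of p k n j 0] by simp
  have coeff_0_nonzero: "coeff (trunc_poly n k a) 0 \<noteq> 0"
    using assms(4) smooth by (simp add: coeff_trunc_poly_nonzero)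
  show ?thesis
    unfolding eisenstein_at_reflect_poly_iff [OF coeff_0_nonzero] deg
  proof (intro conjI ballI)
    show "0 < k"
      by fact
    show "\<not> int p dvd coeff (trunc_poly n k a) 0"
      using dvd_coeff [of 0 1] by simp
    show "int p dvd coeff (trunc_poly n k a) i" if "i \<in> {0<..k}" for i
      using dvd_coeff [of i 1] that assms(5) by simp
    show "\<not> int p ^ 2 dvd coeff (trunc_poly n k a) k"
      using dvd_coeff [of k 2] assms(3,6) by simp
  qed
qed

theorem theorem2:
  fixes n k :: nat and a :: "nat \<Rightarrow> int"
  assumes "n > 0" and "k > 0" and "k \<le> n - 1"
    and "\<exists>p::nat. prime p \<and> p > k \<and> p dvd n * (n - k) \<and> \<not> p ^ 2 dvd n * (n - k)"
    and "\<forall>j\<le>k. prime_factors_at_most k (a j)"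
  shows "irreducible (map_poly rat_of_int (trunc_poly n k a))"
proof -
  obtain p where p: "prime p" "k < p" "p dvd n * (n - k)" "\<not> p ^ 2 dvd n * (n - k)"
    using assms(4) by blast
  then have prime_elem: "prime_elem (int p)" and not_square: "\<not> p ^ 2 dvd n" "\<not> p ^ 2 dvd n - k"
    by auto
  have "k < n"
    using assms(1,3) by simp
  from p(1,3) consider (dvd_n) "p dvd n" | (dvd_n_minus_k) "p dvd n - k"
    by (auto simp: prime_dvd_mult_iff)
  then show ?thesis
  proof cases
    case dvd_n
    then show ?thesis
      using p(1,2) assms(2,5) \<open>k < n\<close> not_square(1)
      by (intro irreducible_eisenstein_reflect_rat [OF prime_elem]
          eisenstein_at_reflect_trunc_poly coeff_trunc_poly_nonzero) auto
  next
    case dvd_n_minus_k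
    then show ?thesis
      using p(1,2) assms(2,5) \<open>k < n\<close> not_square(2)
      by (intro irreducible_eisenstein_rat [OF prime_elem] eisenstein_at_trunc_poly) auto
  qed
qed

end
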